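(* Let $n=1$, $G=[-1,1]\subset\mathbb{R}^1$, and consider the Hamiltonian $$H(y,x,\varepsilon)=h(y)+\varepsilon P(y),\qquad h(y)=\omega y+g(y),\qquad (y,x)\in G\times\mathbb{T}^1,$$ where $P$ is real analytic on $G$, $\varepsilon>0$ is a small parameter, and $\omega\in\mathbb{R}$ satisfies the Diophantine condition $|k\omega|>\gamma/|k|^\tau$ for all $k\in\mathbb{Z}\setminus\{0\}$, with $\gamma>0$ and $\tau>0$. Let $\ell$ be a positive integer. (1) If $g\in C^{2\ell+1}$, $g'(0)=\cdots=g^{(2\ell)}(0)=0$ and $g^{(2\ell+1)}(0)\neq0$, then the perturbed system admits at least two invariant tori with frequency $\omega$ for small enough perturbation satisfying $\varepsilon P'(y)\,\mathrm{sign}(g^{(2\ell+1)}(0))<0$ for $y\in G$; conversely, if $\varepsilon P'(y)\,\mathrm{sign}(g^{(2\ell+1)}(0))>0$ for $y\in G$, the unperturbed invariant torus with frequency $\omega$ will be destroyed. (2) If $g\in C^{2\ell+2}$, $g'(0)=\cdots=g^{(2\ell+1)}(0)=0$ and $g^{(2\ell+2)}(0)\neq0$, then the perturbed system admits an invariant torus with frequency $\omega$ for any small enough perturbation.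
   Context: $\mathbb{T}^1$ is the circle (angle variable $x$) and $y$ is the action variable. The perturbation is $\varepsilon P(y)$; the unperturbed system is the one with Hamiltonian $h$, and its invariant torus with frequency $\omega=h'(0)$ referred to in (1) is $\{y=0\}\times\mathbb{T}^1$. The perturbed equations of motion are $\dot y=0$, $\dot x=h'(y)+\varepsilon P'(y)$, so each circle $\{y=\mathrm{const}\}\times\mathbb{T}^1$ with $y\in G$ is invariant, with frequency $h'(y)+\varepsilon P'(y)$. $g^{(j)}$ denotes the $j$-th derivative of $g$, and $\mathrm{sign}$ is the sign of a nonzero real number. *)

theory Defs
  imports "HOL-Analysis.Analysis"
begin

text \<open>Derivatives are taken relative to the set \<open>S\<close>: at an endpoint of a compact interval they
  are one-sided, so only the values of a function on \<open>S\<close> matter.\<close>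

primrec nderiv_on :: "real set \<Rightarrow> nat \<Rightarrow> (real \<Rightarrow> real) \<Rightarrow> real \<Rightarrow> real" where
  "nderiv_on S 0 f = f"
| "nderiv_on S (Suc n) f = (\<lambda>x. vector_derivative (nderiv_on S n f) (at x within S))"

definition Ck_on :: "nat \<Rightarrow> (real \<Rightarrow> real) \<Rightarrow> real set \<Rightarrow> bool" where
  "Ck_on k f S \<longleftrightarrow>
     (\<forall>j<k. nderiv_on S j f differentiable_on S) \<and> continuous_on S (nderiv_on S k f)"

text \<open>On a nondegenerate interval \<open>S\<close> this is the same as having an analytic extension to an open
  neighbourhood of \<open>S\<close>: a power series converging to \<open>f\<close> on one side of its centre converges on
  the full interval of radius \<open>r\<close>.\<close>

definition real_analytic_on :: "(real \<Rightarrow> real) \<Rightarrow> real set \<Rightarrow> bool" where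
  "real_analytic_on f S \<longleftrightarrow>
     (\<forall>x\<in>S. \<exists>r>0. \<exists>a. \<forall>y\<in>S. \<bar>y - x\<bar> < r \<longrightarrow> (\<lambda>n. a n * (y - x) ^ n) sums f y)"

definition diophantine :: "real \<Rightarrow> real \<Rightarrow> real \<Rightarrow> bool" where
  "diophantine \<gamma> \<tau> \<omega> \<longleftrightarrow> (\<forall>k::int. k \<noteq> 0 \<longrightarrow> \<bar>of_int k * \<omega>\<bar> > \<gamma> / \<bar>of_int k\<bar> powr \<tau>)"

text \<open>The phase space \<open>G \<times> \<T>\<^sup>1\<close> is a subset of \<^typ>\<open>real \<times> complex\<close>, the circle being the unit
  circle with angle coordinate \<open>x \<mapsto> cis x\<close>. A Hamiltonian \<open>H y x\<close> is given on the universal cover,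
  and a solution is a pair of curves \<open>Y\<close>, \<open>X\<close>, where \<open>X\<close> is a continuous lift of the angle.\<close>

definition circle :: "complex set" where
  "circle = sphere 0 1"

definition hamilton_solution ::
  "real set \<Rightarrow> (real \<Rightarrow> real \<Rightarrow> real) \<Rightarrow> (real \<Rightarrow> real) \<Rightarrow> (real \<Rightarrow> real) \<Rightarrow> bool" where
  "hamilton_solution G H Y X \<longleftrightarrow>
     (\<forall>t. Y t \<in> G \<and>
       (\<exists>a b. ((\<lambda>y. H y (X t)) has_real_derivative a) (at (Y t) within G) \<and>
              ((\<lambda>x. H (Y t) x) has_real_derivative b) (at (X t)) \<and>
              (X has_real_derivative a) (at t) \<and>
              (Y has_real_derivative - b) (at t)))"

text \<open>An invariant torus with frequency \<open>\<omega>\<close> is an embedded circle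
  \<open>\<theta> \<mapsto> (v \<theta>, \<theta> + u \<theta>)\<close>, homotopic to \<open>{y} \<times> \<T>\<^sup>1\<close> and traversed in the direction of increasing
  angle, on which the Hamiltonian flow is the rotation \<open>\<theta> \<mapsto> \<theta> + \<omega> t\<close>.\<close>

definition invariant_torus ::
  "real set \<Rightarrow> (real \<Rightarrow> real \<Rightarrow> real) \<Rightarrow> real \<Rightarrow> (real \<times> complex) set \<Rightarrow> bool" where
  "invariant_torus G H \<omega> T \<longleftrightarrow>
     (\<exists>v u :: real \<Rightarrow> real.
        continuous_on UNIV v \<and> continuous_on UNIV u \<and>
        (\<forall>\<theta>. v (\<theta> + 2 * pi) = v \<theta>) \<and> (\<forall>\<theta>. u (\<theta> + 2 * pi) = u \<theta>) \<and>
        inj_on (\<lambda>\<theta>. (v \<theta>, cis (\<theta> + u \<theta>))) {0..<2 * pi} \<and>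
        T = range (\<lambda>\<theta>. (v \<theta>, cis (\<theta> + u \<theta>))) \<and>
        (\<forall>\<theta>. hamilton_solution G H
               (\<lambda>t. v (\<theta> + \<omega> * t)) (\<lambda>t. \<theta> + \<omega> * t + u (\<theta> + \<omega> * t))))"

end

theory Submission
  imports Defs
begin

text \<open>Every circle \<open>{y} \<times> \<T>\<^sup>1\<close> is invariant with frequency \<open>H' y\<close>, and as \<open>\<omega> \<noteq> 0\<close> every invariant torus with
  frequency \<open>\<omega>\<close> lies over a single \<open>y\<close>. Hence everything reduces to the zeros of \<open>g' + \<epsilon> P'\<close>.
  By Taylor's formula \<open>g'\<close> behaves near \<open>0\<close> like \<open>c y\<^sup>m\<close> with \<open>m = 2l\<close> or \<open>m = 2l + 1\<close>, which decides
  the signs of \<open>g' + \<epsilon> P'\<close> at \<open>0\<close> and \<open>\<plusminus>\<delta>\<close>; zeros are then produced by Darboux's theorem.\<close>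

section \<open>Signs of derivatives\<close>

text \<open>Darboux's argument: when the slopes at both ends of \<open>{a..b}\<close> point inwards,
  a minimum of \<open>f\<close> over the interval cannot sit at an end, so it is interior and
  critical. It works with \<open>f\<close> itself rather than with continuity of
  \<open>f'\<close>.\<close>

lemma deriv_zero_of_sign_change:
  fixes f f' :: "real \<Rightarrow> real"
  assumes ab: "a < b"
    and der: "\<And>x. a \<le> x \<Longrightarrow> x \<le> b \<Longrightarrow> (f has_real_derivative f' x) (at x)"
    and sgn: "f' a * f' b < 0"
  shows "\<exists>z. a < z \<and> z < b \<and> f' z = 0"
proof -
  have main: "\<exists>z. a < z \<and> z < b \<and> k' z = 0"
    if der: "\<And>x. a \<le> x \<Longrightarrow> x \<le> b \<Longrightarrow> (k has_real_derivative k' x) (at x)"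
      and neg: "k' a < 0" and pos: "k' b > 0" for k k' :: "real \<Rightarrow> real"
  proof -
    have "continuous_on {a..b} k"
      using der by (intro DERIV_continuous_on[where D = k'])
        (auto intro: has_field_derivative_at_within)
    then obtain z where z: "z \<in> {a..b}" and min: "\<And>y. y \<in> {a..b} \<Longrightarrow> k z \<le> k y"
      using continuous_attains_inf[of "{a..b}" k] ab by auto
    have "z \<noteq> a"
    proof
      assume "z = a"
      obtain d where d: "d > 0" "\<forall>h>0. h < d \<longrightarrow> k a > k (a + h)"
        using DERIV_neg_dec_right[OF der neg] ab by auto
      \<comment> \<open>Half of \<open>d\<close> stays strictly below \<open>d\<close>, and the cap
        \<open>b - a\<close> keeps \<open>a + h\<close> in the interval.\<close>
      define h where "h = min (d / 2) (b - a)"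
      have "h > 0" "h < d" "a + h \<in> {a..b}" using d ab by (auto simp: h_def)
      then show False using d(2) min[of "a + h"] \<open>z = a\<close> by force
    qed
    moreover have "z \<noteq> b"
    proof
      assume "z = b"
      obtain d where d: "d > 0" "\<forall>h>0. h < d \<longrightarrow> k (b - h) < k b"
        using DERIV_pos_inc_left[OF der pos] ab by auto
      define h where "h = min (d / 2) (b - a)"
      have "h > 0" "h < d" "b - h \<in> {a..b}" using d ab by (auto simp: h_def)
      then show False using d(2) min[of "b - h"] \<open>z = b\<close> by force
    qed
    ultimately have z': "a < z" "z < b" using z by auto
    have "k' z = 0"
    proof (rule DERIV_local_min[OF der])
      show "0 < min (z - a) (b - z)" using z' by simp
      show "\<forall>y. \<bar>z - y\<bar> < min (z - a) (b - z) \<longrightarrow> k z \<le> k y"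
        by (auto intro!: min simp: abs_less_iff)
    qed (use z in auto)
    then show ?thesis using z' by blast
  qed
  show ?thesis
  proof (cases "f' a < 0")
    case True
    then have "f' b > 0" using sgn by (simp add: mult_less_0_iff)
    then show ?thesis using main[OF der True] by blast
  next
    case False
    \<comment> \<open>The opposite sign pattern reduces to the first one by passing to
      \<open>- f\<close>.\<close>
    then have "- f' a < 0" "- f' b > 0" using sgn by (auto simp: mult_less_0_iff)
    then show ?thesis
      using main[of "\<lambda>x. - f x" "\<lambda>x. - f' x"] der by (auto intro: DERIV_minus)
  qed
qed

text \<open>This takes the place of Taylor's formula: descending from \<open>k\<close> to
  \<open>j\<close>, each \<open>D n\<close> vanishes at 0, so the mean value theorem passes the sign
  of \<open>D (Suc n)\<close> on to \<open>D n\<close> at the cost of one factor \<open>y\<close>.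
  The power \<open>y ^ (k - j)\<close> records how the sign depends on the side of 0.\<close>

lemma sign_near_zero_of_derivatives:
  fixes D :: "nat \<Rightarrow> real \<Rightarrow> real"
  assumes "j \<le> k"
    and e: "e > 0"
    and der: "\<And>i y. i < k \<Longrightarrow> \<bar>y\<bar> < e \<Longrightarrow> (D i has_real_derivative D (Suc i) y) (at y)"
    and cont: "isCont (D k) 0"
    and zero: "\<And>i. j \<le> i \<Longrightarrow> i < k \<Longrightarrow> D i 0 = 0"
    and nz: "D k 0 \<noteq> 0"
  shows "\<exists>d>0. \<forall>y. 0 < \<bar>y\<bar> \<and> \<bar>y\<bar> < d \<longrightarrow> D k 0 * D j y * y ^ (k - j) > 0"
  using \<open>j \<le> k\<close> zero
proof (induction rule: inc_induct)
  case base
  \<comment> \<open>For \<open>j = k\<close> the power is 1, and the claim is continuity around the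
    positive value \<open>D k 0 * D k 0\<close>.\<close>
  have "isCont (\<lambda>y. D k 0 * D k y) 0" using cont by (intro continuous_intros)
  moreover have "0 < D k 0 * D k 0" using nz by (metis not_real_square_gt_zero)
  ultimately have "\<forall>\<^sub>F y in nhds 0. 0 < D k 0 * D k y"
    unfolding continuous_at tendsto_at_iff_tendsto_nhds[of "\<lambda>y. D k 0 * D k y"]
    by (rule order_tendstoD(1))
  then show ?case by (auto simp: eventually_nhds_metric dist_real_def)
next
  case (step n)
  obtain d where d: "d > 0"
    "\<And>y. 0 < \<bar>y\<bar> \<Longrightarrow> \<bar>y\<bar> < d \<Longrightarrow> D k 0 * D (Suc n) y * y ^ (k - Suc n) > 0"
    using step.IH step.prems by force
  have "D k 0 * D n y * y ^ (k - n) > 0" if y: "0 < \<bar>y\<bar>" "\<bar>y\<bar> < min d e" for y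
  proof -
    have n0: "D n 0 = 0" using step by auto
    \<comment> \<open>The mean value point lies strictly between 0 and \<open>y\<close>;
      \<open>z * y > 0\<close> says this for both signs of \<open>y\<close>.\<close>
    have "\<exists>z. \<bar>z\<bar> < \<bar>y\<bar> \<and> z * y > 0 \<and> D n y = y * D (Suc n) z"
    proof (cases "y > 0")
      case True
      obtain z where "0 < z" "z < y" "D n y - D n 0 = (y - 0) * D (Suc n) z"
        using MVT2[of 0 y "D n" "D (Suc n)"] der[of n] step True y by auto
      then show ?thesis using n0 True by (intro exI[of _ z]) auto
    next
      case False
      then have neg: "y < 0" using y by auto
      obtain z where "y < z" "z < 0" "D n 0 - D n y = (0 - y) * D (Suc n) z"
        using MVT2[of y 0 "D n" "D (Suc n)"] der[of n] step neg y by auto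
      then show ?thesis using n0 neg by (intro exI[of _ z]) (auto simp: mult_neg_neg)
    qed
    then obtain z where z: "\<bar>z\<bar> < \<bar>y\<bar>" "z * y > 0" "D n y = y * D (Suc n) z" by blast
    have "D k 0 * D (Suc n) z * z ^ (k - Suc n) > 0"
      using d(2)[of z] z y by (cases "z = 0") auto
    \<comment> \<open>Multiplying by this positive power trades the power of \<open>z\<close> for
      one of \<open>y\<close>: what remains of \<open>z\<close> is a square, which can be
      cancelled.\<close>
    moreover have "(z * y) ^ (k - Suc n) > 0" using z by simp
    ultimately have "(D k 0 * D (Suc n) z * z ^ (k - Suc n)) * (z * y) ^ (k - Suc n) > 0"
      by (rule mult_pos_pos)
    then have "(D k 0 * D (Suc n) z * y ^ (k - Suc n)) * (z ^ (k - Suc n))\<^sup>2 > 0"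
      by (simp add: power_mult_distrib power2_eq_square algebra_simps)
    then have "D k 0 * D (Suc n) z * y ^ (k - Suc n) > 0"
      by (metis zero_less_mult_pos2 zero_less_power2 mult_zero_right order_less_irrefl
          power_zero_numeral)
    \<comment> \<open>One factor \<open>y\<close> comes from the mean value formula, the other from
      the exponent growing by one.\<close>
    moreover have "y\<^sup>2 > 0" using y by simp
    ultimately have "D k 0 * D (Suc n) z * y ^ (k - Suc n) * y\<^sup>2 > 0"
      by (rule mult_pos_pos)
    moreover have "k - n = Suc (k - Suc n)" using step by simp
    ultimately show ?thesis using z(3) by (simp add: power2_eq_square algebra_simps)
  qed
  then show ?case using d(1) e by (intro exI[of _ "min d e"]) auto
qed

text \<open>Continuity in \<open>\<epsilon>\<close> at 0. At a fixed point where the first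
  derivative of \<open>g\<close> is nonzero, this yields the threshold below which the perturbation
  cannot change its sign.\<close>

lemma sign_stable_under_small_perturbation:
  fixes x p c :: real
  assumes "0 < c * x"
  shows "\<exists>e>0. \<forall>\<epsilon>. 0 < \<epsilon> \<and> \<epsilon> < e \<longrightarrow> 0 < c * (x + \<epsilon> * p)"
proof -
  have "((\<lambda>\<epsilon>. c * (x + \<epsilon> * p)) \<longlongrightarrow> c * (x + 0 * p)) (at_right 0)"
    by (intro tendsto_intros)
  then have "\<forall>\<^sub>F \<epsilon> in at_right 0. 0 < c * (x + \<epsilon> * p)"
    using assms by (auto dest: order_tendstoD(1))
  then show ?thesis by (auto simp: eventually_at_right_field)
qed

section \<open>From relative to two-sided derivatives\<close>

lemma nderiv_on_has_real_derivative:
  assumes "nderiv_on S n f differentiable_on S" and "x \<in> interior S"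
  shows "(nderiv_on S n f has_real_derivative nderiv_on S (Suc n) f x) (at x)"
proof -
  have "x \<in> S" using assms(2) interior_subset by blast
  then have "(nderiv_on S n f has_vector_derivative nderiv_on S (Suc n) f x) (at x within S)"
    using differentiable_onD[OF assms(1)] by (simp add: vector_derivative_works[symmetric])
  then show ?thesis
    using at_within_interior[OF assms(2)] by (simp add: has_real_derivative_iff_has_vector_derivative)
qed

text \<open>The power series centred at \<open>x\<close> is differentiated termwise at its centre;
  as \<open>x\<close> is interior, the series represents \<open>f\<close> on a full
  neighbourhood.\<close>

lemma real_analytic_on_has_real_derivative:
  assumes "real_analytic_on f S" and "x \<in> interior S"
  shows "(f has_real_derivative nderiv_on S 1 f x) (at x)"
proof -
  have xS: "x \<in> S" using assms(2) interior_subset by blast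
  then obtain r a where r: "r > 0"
    "\<And>y. y \<in> S \<Longrightarrow> \<bar>y - x\<bar> < r \<Longrightarrow> (\<lambda>n. a n * (y - x) ^ n) sums f y"
    using assms(1) unfolding real_analytic_on_def by blast
  obtain e where e: "e > 0" "ball x e \<subseteq> S"
    using assms(2) mem_interior by blast
  \<comment> \<open>Within radius \<open>s\<close> the expansion is valid and \<open>x + z\<close>
    stays in \<open>S\<close>.\<close>
  define s where "s = min r e"
  have s: "s > 0" using r e by (simp add: s_def)
  have sums: "(\<lambda>n. a n * z ^ n) sums f (x + z)" if "\<bar>z\<bar> < s" for z
  proof -
    have "x + z \<in> S" using e that by (auto simp: s_def dist_real_def)
    then show ?thesis using r(2)[of "x + z"] that by (simp add: s_def)
  qed
  have "((\<lambda>z. \<Sum>n. a n * z ^ n) has_real_derivative (\<Sum>n. diffs a n * 0 ^ n)) (at 0)"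
    by (rule termdiffs_strong'[of s]) (use s sums in \<open>auto intro: sums_summable\<close>)
  then have "((\<lambda>z. f (x + z)) has_real_derivative (\<Sum>n. diffs a n * 0 ^ n)) (at 0)"
    by (rule has_field_derivative_transform_within[OF _ s])
      (use sums in \<open>auto simp: sums_iff\<close>)
  then have "(f has_real_derivative (\<Sum>n. diffs a n * 0 ^ n)) (at x)"
    using DERIV_shift[of f _ 0 x] by (simp add: add.commute)
  moreover from this have "nderiv_on S 1 f x = (\<Sum>n. diffs a n * 0 ^ n)"
    using at_within_interior[OF assms(2)]
    by (simp add: has_real_derivative_iff_has_vector_derivative vector_derivative_at)
  ultimately show ?thesis by simp
qed

section \<open>Invariant tori of an angle-independent Hamiltonian\<close>

text \<open>The instance \<open>k = 1\<close> reads
  \<open>\<bar>\<omega>\<bar> > \<gamma>\<close>.\<close>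

lemma diophantine_nonzero:
  assumes "diophantine \<gamma> \<tau> \<omega>" and "\<gamma> > 0"
  shows "\<omega> \<noteq> 0"
  using assms unfolding diophantine_def by (auto dest: spec[of _ 1])

lemma range_pair_cis: "range (\<lambda>\<theta>. (y :: real, cis \<theta>)) = {y} \<times> circle"
proof -
  have "z \<in> range cis" if "cmod z = 1" for z
    using complex_unimodular_polar[OF that] by (metis cis.code rangeI)
  then have "range cis = circle" by (auto simp: circle_def)
  then show ?thesis by force
qed

lemma inj_on_cis: "inj_on cis {0..<2 * pi}"
proof (rule inj_onI)
  fix x y assume xy: "x \<in> {0..<2 * pi}" "y \<in> {0..<2 * pi}" "cis x = cis y"
  then have "sin x = sin y \<and> cos x = cos y" by (metis cis.sel)
  then obtain n :: int where n: "x = y + 2 * pi * n" using sin_cos_eq_iff by blast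
  have "\<bar>x - y\<bar> < 2 * pi" using xy by auto
  then have "2 * pi * \<bar>real_of_int n\<bar> < 2 * pi * 1"
    using n by (simp add: abs_mult)
  then have "\<bar>real_of_int n\<bar> < 1" by (rule mult_left_less_imp_less) simp
  then show "x = y" using n by auto
qed

lemma invariant_torus_circle:
  assumes "y \<in> G" and "(F has_real_derivative \<omega>) (at y within G)"
  shows "invariant_torus G (\<lambda>y x. F y) \<omega> ({y} \<times> circle)"
  unfolding invariant_torus_def
\<comment> \<open>The parametrisation has \<open>v\<close> constantly \<open>y\<close> and
  \<open>u\<close> constantly 0.\<close>
proof (intro exI conjI allI)
  show "inj_on (\<lambda>\<theta>. (y, cis (\<theta> + (\<lambda>_. 0) \<theta>))) {0..<2 * pi}"
    using inj_on_cis by (auto simp: inj_on_def)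
  show "{y} \<times> circle = range (\<lambda>\<theta>. (y, cis (\<theta> + (\<lambda>_. 0) \<theta>)))"
    by (simp add: range_pair_cis)
  show "hamilton_solution G (\<lambda>y x. F y) (\<lambda>t. y) (\<lambda>t. \<theta> + \<omega> * t + (\<lambda>_. 0) (\<theta> + \<omega> * t))" for \<theta>
    unfolding hamilton_solution_def
  proof (intro allI conjI exI)
    show "((\<lambda>t. \<theta> + \<omega> * t + (\<lambda>_. 0) (\<theta> + \<omega> * t)) has_real_derivative \<omega>) (at t)" for t
      by (auto intro!: derivative_eq_intros)
    show "((\<lambda>x. F y) has_real_derivative 0) (at x)" "((\<lambda>t. y) has_real_derivative - 0) (at t)" for x t
      by auto
  qed (use assms in auto)
qed auto

text \<open>Along a solution \<open>Y\<close> is constant, so the angle grows linearly; as it increases by \<open>2\<pi>\<close> in time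
  \<open>2\<pi>/\<omega>\<close>, its slope is \<open>\<omega>\<close>.\<close>

lemma invariant_torus_frequency:
  assumes torus: "invariant_torus G (\<lambda>y x. F y) \<omega> T" and "\<omega> \<noteq> 0"
    and nontrivial: "\<And>y. y \<in> G \<Longrightarrow> at y within G \<noteq> bot"
  shows "\<exists>y\<in>G. (F has_real_derivative \<omega>) (at y within G) \<and> y \<in> fst ` T"
proof -
  obtain v u :: "real \<Rightarrow> real" where per: "\<And>\<theta>. u (\<theta> + 2 * pi) = u \<theta>"
    and T: "T = range (\<lambda>\<theta>. (v \<theta>, cis (\<theta> + u \<theta>)))"
    and sol: "\<And>\<theta>. hamilton_solution G (\<lambda>y x. F y)
               (\<lambda>t. v (\<theta> + \<omega> * t)) (\<lambda>t. \<theta> + \<omega> * t + u (\<theta> + \<omega> * t))"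
    using torus unfolding invariant_torus_def by blast
  \<comment> \<open>The orbit through the parameter value 0 suffices.\<close>
  define X where "X = (\<lambda>t. \<omega> * t + u (\<omega> * t))"
  define Y where "Y = (\<lambda>t. v (\<omega> * t))"
  have S: "Y t \<in> G \<and> (\<exists>a b. (F has_real_derivative a) (at (Y t) within G) \<and>
              ((\<lambda>x. F (Y t)) has_real_derivative b) (at (X t)) \<and>
              (X has_real_derivative a) (at t) \<and>
              (Y has_real_derivative - b) (at t))" for t
    using sol[of 0] unfolding hamilton_solution_def X_def Y_def by simp
  \<comment> \<open>The Hamiltonian is constant in the angle, so uniqueness of derivatives forces
    \<open>b = 0\<close>.\<close>
  have "(Y has_real_derivative 0) (at t)" for t
    using S[of t] DERIV_unique[OF DERIV_const] by fastforce
  then have Yc: "Y t = Y 0" for t by (intro DERIV_isconst_all) auto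
  obtain a where a: "(F has_real_derivative a) (at (Y 0) within G)" using S by blast
  \<comment> \<open>The speed at time \<open>t\<close> is a derivative of \<open>F\<close> at the
    same point \<open>Y 0\<close>; \<open>nontrivial\<close> makes it unique even where it is
    one-sided.\<close>
  have Xa: "(X has_real_derivative a) (at t)" for t
    using S[of t] a has_field_derivative_unique[OF _ a nontrivial] unfolding Yc[of t] by blast
  have "((\<lambda>t. X t - a * t) has_real_derivative 0) (at t)" for t
    by (auto intro!: derivative_eq_intros Xa)
  then have "X (2 * pi / \<omega>) - a * (2 * pi / \<omega>) = X 0 - a * 0"
    by (intro DERIV_isconst_all) auto
  moreover have "X (2 * pi / \<omega>) = X 0 + 2 * pi"
    using per[of 0] \<open>\<omega> \<noteq> 0\<close> by (simp add: X_def)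
  ultimately have "a = \<omega>" using \<open>\<omega> \<noteq> 0\<close> by (simp add: field_simps)
  moreover have "Y 0 \<in> fst ` T" by (force simp: T Y_def)
  ultimately show ?thesis using a S by blast
qed

section \<open>Tori from the order of vanishing at 0\<close>

text \<open>The sign lemma applied to the chain of derivatives of \<open>g\<close>, starting from
  the first. The parity of \<open>m\<close> separates the two cases of the theorem: for even
  \<open>m\<close> the first derivative keeps its sign across 0, for odd \<open>m\<close> it changes
  it.\<close>

lemma Ck_on_sign_of_first_derivative:
  fixes g :: "real \<Rightarrow> real"
  assumes "Ck_on (Suc m) g G" and int: "0 \<in> interior G"
    and "\<forall>j\<in>{1..m}. nderiv_on G j g 0 = 0" and "nderiv_on G (Suc m) g 0 \<noteq> 0"
  shows "\<exists>d>0. \<forall>y. 0 < \<bar>y\<bar> \<and> \<bar>y\<bar> < d \<longrightarrow> nderiv_on G (Suc m) g 0 * nderiv_on G 1 g y * y ^ m > 0"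
proof -
  obtain e where e: "e > 0" "ball 0 e \<subseteq> interior G"
    using int open_interior open_contains_ball by blast
  have "continuous_on (interior G) (nderiv_on G (Suc m) g)"
    using assms(1) unfolding Ck_on_def by (meson continuous_on_subset interior_subset)
  then have "isCont (nderiv_on G (Suc m) g) 0"
    using int continuous_on_eq_continuous_at open_interior by blast
  moreover have "(nderiv_on G i g has_real_derivative nderiv_on G (Suc i) g y) (at y)"
    if "i < Suc m" "\<bar>y\<bar> < e" for i y
    using that assms(1) e by (intro nderiv_on_has_real_derivative) (auto simp: Ck_on_def)
  ultimately show ?thesis
    using sign_near_zero_of_derivatives[of 1 "Suc m" e "\<lambda>j. nderiv_on G j g"] e(1) assms(3,4)
    by simp
qed

theorem theorem4:
  fixes P g h :: "real \<Rightarrow> real" and G :: "real set" and H :: "real \<Rightarrow> real \<Rightarrow> real \<Rightarrow> real"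
    and \<omega> \<gamma> \<tau> :: real and l :: nat
  assumes G: "G = {-1..1}"
    and P: "real_analytic_on P G"
    and "\<gamma> > 0" and "\<tau> > 0" and "diophantine \<gamma> \<tau> \<omega>"
    and "l > 0"
    and h: "h = (\<lambda>y. \<omega> * y + g y)"
    and H: "H = (\<lambda>\<epsilon> y x. h y + \<epsilon> * P y)"
  shows
    "(Ck_on (2 * l + 1) g G \<and>
      (\<forall>j\<in>{1..2 * l}. nderiv_on G j g 0 = 0) \<and> nderiv_on G (2 * l + 1) g 0 \<noteq> 0 \<longrightarrow>
        (\<exists>\<epsilon>0>0. \<forall>\<epsilon>. 0 < \<epsilon> \<and> \<epsilon> < \<epsilon>0 \<and>
            (\<forall>y\<in>G. \<epsilon> * nderiv_on G 1 P y * sgn (nderiv_on G (2 * l + 1) g 0) < 0) \<longrightarrow>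
            (\<exists>T1 T2. T1 \<noteq> T2 \<and> invariant_torus G (H \<epsilon>) \<omega> T1 \<and> invariant_torus G (H \<epsilon>) \<omega> T2)) \<and>
        invariant_torus G (\<lambda>y x. h y) \<omega> ({0} \<times> circle) \<and>
        (\<exists>U. open U \<and> {0} \<times> circle \<subseteq> U \<and>
          (\<forall>\<epsilon>>0.
            (\<forall>y\<in>G. \<epsilon> * nderiv_on G 1 P y * sgn (nderiv_on G (2 * l + 1) g 0) > 0) \<longrightarrow>
            \<not> (\<exists>T\<subseteq>U. invariant_torus G (H \<epsilon>) \<omega> T))))
     \<and>
     (Ck_on (2 * l + 2) g G \<and>
      (\<forall>j\<in>{1..2 * l + 1}. nderiv_on G j g 0 = 0) \<and> nderiv_on G (2 * l + 2) g 0 \<noteq> 0 \<longrightarrow>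
        (\<exists>\<epsilon>0>0. \<forall>\<epsilon>. 0 < \<epsilon> \<and> \<epsilon> < \<epsilon>0 \<longrightarrow>
            (\<exists>T. invariant_torus G (H \<epsilon>) \<omega> T)))"
proof -
  have int: "y \<in> interior G" if "\<bar>y\<bar> < 1" for y
    using that by (auto simp: G abs_less_iff)
  have in_G: "y \<in> G" if "\<bar>y\<bar> < 1" for y
    using that by (auto simp: G)
  have "\<omega> \<noteq> 0" using diophantine_nonzero assms by blast
  have nontrivial: "at y within G \<noteq> bot" if "y \<in> G" for y
    using that by (simp add: G trivial_limit_within islimpt_Icc)
  let ?g = "nderiv_on G 1 g" and ?P = "nderiv_on G 1 P"
  have dh: "((\<lambda>y. h y + \<epsilon> * P y) has_real_derivative \<omega> + (?g y + \<epsilon> * ?P y)) (at y)"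
    if "Ck_on k g G" "k > 0" "\<bar>y\<bar> < 1" for k y \<epsilon>
  proof -
    have "nderiv_on G 0 g differentiable_on G"
      using that unfolding Ck_on_def by blast
    from nderiv_on_has_real_derivative[OF this int] have "(g has_real_derivative ?g y) (at y)"
      using that by simp
    moreover have "(P has_real_derivative ?P y) (at y)"
      using real_analytic_on_has_real_derivative[OF P] int that by blast
    ultimately show ?thesis
      unfolding h by (auto intro!: derivative_eq_intros)
  qed
  have torus: "\<exists>y. a < y \<and> y < b \<and> invariant_torus G (H \<epsilon>) \<omega> ({y} \<times> circle)"
    if C: "Ck_on k g G" "k > 0" and ab: "-1 < a" "a < b" "b < 1"
      and s: "(?g a + \<epsilon> * ?P a) * (?g b + \<epsilon> * ?P b) < 0" for k a b \<epsilon>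
  proof -
    \<comment> \<open>Subtracting \<open>\<omega> * y\<close> turns the search for frequency
      \<open>\<omega>\<close> into the search for a critical point.\<close>
    have "((\<lambda>y. h y + \<epsilon> * P y - \<omega> * y) has_real_derivative ?g y + \<epsilon> * ?P y) (at y)"
      if "a \<le> y" "y \<le> b" for y
      using DERIV_diff[OF dh[OF C, of y \<epsilon>] DERIV_cmult_Id[of \<omega>]] ab that by simp
    from deriv_zero_of_sign_change[OF ab(2) this s]
    obtain y where y: "a < y" "y < b" "?g y + \<epsilon> * ?P y = 0" by blast
    then have "((\<lambda>y. h y + \<epsilon> * P y) has_real_derivative \<omega>) (at y within G)"
      using dh[OF C, of y \<epsilon>] ab by (simp add: has_field_derivative_at_within)
    then have "invariant_torus G (H \<epsilon>) \<omega> ({y} \<times> circle)"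
      using y ab unfolding H by (intro invariant_torus_circle in_G) auto
    then show ?thesis using y by blast
  qed
  have signs: "\<exists>d>0. d < 1 \<and> (\<forall>y. 0 < \<bar>y\<bar> \<and> \<bar>y\<bar> \<le> d \<longrightarrow> nderiv_on G (Suc m) g 0 * ?g y * y ^ m > 0)"
    if C: "Ck_on (Suc m) g G" and z: "\<forall>j\<in>{1..m}. nderiv_on G j g 0 = 0"
      and nz: "nderiv_on G (Suc m) g 0 \<noteq> 0" for m
  proof -
    obtain d where d: "d > 0"
      "\<And>y. 0 < \<bar>y\<bar> \<Longrightarrow> \<bar>y\<bar> < d \<Longrightarrow> nderiv_on G (Suc m) g 0 * ?g y * y ^ m > 0"
      using Ck_on_sign_of_first_derivative[OF C int z nz] by auto
    \<comment> \<open>Shrinking the radius makes the points at distance exactly \<open>d\<close>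
      usable and keeps them inside \<open>G\<close>.\<close>
    then show ?thesis by (intro exI[of _ "min (d / 2) (1 / 2)"]) auto
  qed
  have part1: "(\<exists>\<epsilon>0>0. \<forall>\<epsilon>. 0 < \<epsilon> \<and> \<epsilon> < \<epsilon>0 \<and>
            (\<forall>y\<in>G. \<epsilon> * ?P y * sgn (nderiv_on G (2 * l + 1) g 0) < 0) \<longrightarrow>
            (\<exists>T1 T2. T1 \<noteq> T2 \<and> invariant_torus G (H \<epsilon>) \<omega> T1 \<and> invariant_torus G (H \<epsilon>) \<omega> T2)) \<and>
        invariant_torus G (\<lambda>y x. h y) \<omega> ({0} \<times> circle) \<and>
        (\<exists>U. open U \<and> {0} \<times> circle \<subseteq> U \<and>
          (\<forall>\<epsilon>>0.
            (\<forall>y\<in>G. \<epsilon> * ?P y * sgn (nderiv_on G (2 * l + 1) g 0) > 0) \<longrightarrow>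
            \<not> (\<exists>T\<subseteq>U. invariant_torus G (H \<epsilon>) \<omega> T)))"
    if C: "Ck_on (2 * l + 1) g G" and z: "\<forall>j\<in>{1..2 * l}. nderiv_on G j g 0 = 0"
      and nz: "nderiv_on G (2 * l + 1) g 0 \<noteq> 0"
  proof -
    define c where "c = nderiv_on G (2 * l + 1) g 0"
    obtain d where d: "d > 0" "d < 1"
      and pos: "\<And>y. 0 < \<bar>y\<bar> \<Longrightarrow> \<bar>y\<bar> \<le> d \<Longrightarrow> c * ?g y * y ^ (2 * l) > 0"
      using signs[of "2 * l"] C z nz by (auto simp: c_def)
    \<comment> \<open>The power is even, so \<open>?g\<close> has the sign of \<open>c\<close> on
      both sides of 0.\<close>
    have gpos: "c * ?g y > 0" if "0 < \<bar>y\<bar>" "\<bar>y\<bar> \<le> d" for y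
    proof -
      have "y ^ (2 * l) > 0" using that by (simp add: zero_less_power_eq)
      then show ?thesis using pos[OF that] zero_less_mult_pos2 by blast
    qed
    \<comment> \<open>The index 1 lies in \<open>{1..2 * l}\<close> because
      \<open>l > 0\<close>.\<close>
    have g0: "?g 0 = 0" using \<open>l > 0\<close> by (intro z[rule_format]) auto
    have sgn_c: "x * sgn c > 0 \<longleftrightarrow> c * x > 0" "x * sgn c < 0 \<longleftrightarrow> c * x < 0" for x
      by (auto simp: sgn_if mult_less_0_iff zero_less_mult_iff)
    have "\<exists>T1 T2. T1 \<noteq> T2 \<and> invariant_torus G (H \<epsilon>) \<omega> T1 \<and> invariant_torus G (H \<epsilon>) \<omega> T2"
      if e: "0 < c * (?g d + \<epsilon> * ?P d)" "0 < c * (?g (- d) + \<epsilon> * ?P (- d))"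
        and neg: "\<forall>y\<in>G. \<epsilon> * ?P y * sgn c < 0" for \<epsilon>
    proof -
      \<comment> \<open>At 0 only the perturbation contributes, with sign opposite to
        \<open>c\<close>, whereas at both ends the sum has the sign of \<open>c\<close>. This gives
        one sign change on each side of 0.\<close>
      have "c * (?g 0 + \<epsilon> * ?P 0) < 0" using neg in_G[of 0] g0 sgn_c by simp
      then have "(?g (- d) + \<epsilon> * ?P (- d)) * (?g 0 + \<epsilon> * ?P 0) < 0"
        "(?g 0 + \<epsilon> * ?P 0) * (?g d + \<epsilon> * ?P d) < 0"
        using e by (auto simp: mult_less_0_iff zero_less_mult_iff)
      then obtain y1 y2 where "y1 < 0" "invariant_torus G (H \<epsilon>) \<omega> ({y1} \<times> circle)"
        "0 < y2" "invariant_torus G (H \<epsilon>) \<omega> ({y2} \<times> circle)"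
        using torus[OF C, of "- d" 0 \<epsilon>] torus[OF C, of 0 d \<epsilon>] d by auto
      \<comment> \<open>The tori differ because their actions have opposite signs and the circle is
        nonempty.\<close>
      moreover from this have "{y1} \<times> circle \<noteq> {y2} \<times> circle"
        by (auto simp: times_eq_iff circle_def)
      ultimately show ?thesis by (intro exI conjI)
    qed
    moreover obtain e1 where "e1 > 0"
      "\<forall>\<epsilon>. 0 < \<epsilon> \<and> \<epsilon> < e1 \<longrightarrow> 0 < c * (?g d + \<epsilon> * ?P d)"
      using sign_stable_under_small_perturbation gpos[of d] d by force
    moreover obtain e2 where "e2 > 0"
      "\<forall>\<epsilon>. 0 < \<epsilon> \<and> \<epsilon> < e2 \<longrightarrow> 0 < c * (?g (- d) + \<epsilon> * ?P (- d))"
      using sign_stable_under_small_perturbation gpos[of "- d"] d by force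
    ultimately have two: "\<exists>\<epsilon>0>0. \<forall>\<epsilon>. 0 < \<epsilon> \<and> \<epsilon> < \<epsilon>0 \<and> (\<forall>y\<in>G. \<epsilon> * ?P y * sgn c < 0) \<longrightarrow>
        (\<exists>T1 T2. T1 \<noteq> T2 \<and> invariant_torus G (H \<epsilon>) \<omega> T1 \<and> invariant_torus G (H \<epsilon>) \<omega> T2)"
      by (intro exI[of _ "min e1 e2"]) simp
    have unperturbed: "invariant_torus G (\<lambda>y x. h y) \<omega> ({0} \<times> circle)"
      using dh[OF C, of 0 0] g0 in_G[of 0]
      by (intro invariant_torus_circle) (auto intro: has_field_derivative_at_within)
    \<comment> \<open>The strip where \<open>gpos\<close> controls \<open>?g\<close>; it is chosen
      before \<open>\<epsilon>\<close>, so one neighbourhood serves all perturbations.\<close>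
    let ?U = "{- d<..<d} \<times> (UNIV :: complex set)"
    have "\<not> (\<exists>T\<subseteq>?U. invariant_torus G (H \<epsilon>) \<omega> T)"
      if "\<forall>y\<in>G. \<epsilon> * ?P y * sgn c > 0" for \<epsilon>
    proof
      assume "\<exists>T\<subseteq>?U. invariant_torus G (H \<epsilon>) \<omega> T"
      then obtain T where T: "T \<subseteq> ?U" "invariant_torus G (\<lambda>y x. h y + \<epsilon> * P y) \<omega> T"
        unfolding H by blast
      obtain y where y: "y \<in> G" "y \<in> fst ` T"
        and dy: "((\<lambda>y. h y + \<epsilon> * P y) has_real_derivative \<omega>) (at y within G)"
        using invariant_torus_frequency[OF T(2) \<open>\<omega> \<noteq> 0\<close> nontrivial] by blast
      have yd: "\<bar>y\<bar> < d" using y(2) subsetD[OF T(1)] by (fastforce simp: abs_less_iff)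
      \<comment> \<open>Two values of the same derivative force
        \<open>?g y + \<epsilon> * ?P y = 0\<close>. After multiplication by \<open>c\<close>,
        however, the first summand is nonnegative and the second positive.\<close>
      then have "\<omega> + (?g y + \<epsilon> * ?P y) = \<omega>"
        using has_field_derivative_unique[OF has_field_derivative_at_within[OF dh[OF C]] dy nontrivial] y d
        by auto
      then have "c * (?g y + \<epsilon> * ?P y) = 0" by simp
      then have "c * ?g y + c * (\<epsilon> * ?P y) = 0" by (simp add: distrib_left)
      moreover have "c * (\<epsilon> * ?P y) > 0" using that y sgn_c by blast
      moreover have "c * ?g y \<ge> 0" using gpos[of y] g0 yd by (cases "y = 0") auto
      ultimately show False by linarith
    qed
    moreover have "open ?U" "{0} \<times> circle \<subseteq> ?U" using d by (auto intro: open_Times)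
    ultimately have destroyed: "\<exists>U. open U \<and> {0} \<times> circle \<subseteq> U \<and>
          (\<forall>\<epsilon>>0. (\<forall>y\<in>G. \<epsilon> * ?P y * sgn c > 0) \<longrightarrow> \<not> (\<exists>T\<subseteq>U. invariant_torus G (H \<epsilon>) \<omega> T))"
      by blast
    show ?thesis using two unperturbed destroyed unfolding c_def by blast
  qed
  have part2: "\<exists>\<epsilon>0>0. \<forall>\<epsilon>. 0 < \<epsilon> \<and> \<epsilon> < \<epsilon>0 \<longrightarrow> (\<exists>T. invariant_torus G (H \<epsilon>) \<omega> T)"
    if C: "Ck_on (2 * l + 2) g G" and z: "\<forall>j\<in>{1..2 * l + 1}. nderiv_on G j g 0 = 0"
      and nz: "nderiv_on G (2 * l + 2) g 0 \<noteq> 0"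
  proof -
    define c where "c = nderiv_on G (2 * l + 2) g 0"
    \<comment> \<open>The successor form matches the shape of \<open>signs\<close> with
      \<open>m = 2 * l + 1\<close>.\<close>
    have c': "nderiv_on G (Suc (2 * l + 1)) g 0 = c" by (simp add: c_def)
    obtain d where d: "d > 0" "d < 1"
      and pos: "\<And>y. 0 < \<bar>y\<bar> \<Longrightarrow> \<bar>y\<bar> \<le> d \<Longrightarrow> c * ?g y * y ^ (2 * l + 1) > 0"
      using signs[of "2 * l + 1", unfolded c'] C z nz c_def by auto
    \<comment> \<open>The power is odd, so \<open>?g\<close> takes opposite signs at
      \<open>d\<close> and \<open>- d\<close>. Small perturbations of either sign preserve these
      signs, and a zero lies in between.\<close>
    have dp: "d ^ (2 * l + 1) > 0" and dn: "(- d) ^ (2 * l + 1) < 0"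
      using d by (simp, subst power_less_zero_eq) auto
    have "c * ?g d * d ^ (2 * l + 1) > 0" using pos[of d] d by auto
    then have 1: "c * ?g d > 0" using dp by (rule zero_less_mult_pos2)
    have "c * ?g (- d) * (- d) ^ (2 * l + 1) > 0" using pos[of "- d"] d by auto
    then have "c * ?g (- d) < 0" using dn by (meson order.asym zero_less_mult_iff)
    then have 2: "- c * ?g (- d) > 0" by simp
    obtain e1 where e1: "e1 > 0" "\<forall>\<epsilon>. 0 < \<epsilon> \<and> \<epsilon> < e1 \<longrightarrow> 0 < c * (?g d + \<epsilon> * ?P d)"
      using sign_stable_under_small_perturbation[OF 1] by blast
    obtain e2 where e2: "e2 > 0" "\<forall>\<epsilon>. 0 < \<epsilon> \<and> \<epsilon> < e2 \<longrightarrow> 0 < - c * (?g (- d) + \<epsilon> * ?P (- d))"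
      using sign_stable_under_small_perturbation[OF 2] by blast
    have "\<exists>T. invariant_torus G (H \<epsilon>) \<omega> T" if "0 < \<epsilon>" "\<epsilon> < min e1 e2" for \<epsilon>
    proof -
      have "0 < c * (?g d + \<epsilon> * ?P d)" "0 < - c * (?g (- d) + \<epsilon> * ?P (- d))"
        using e1(2) e2(2) that by auto
      then have "(?g (- d) + \<epsilon> * ?P (- d)) * (?g d + \<epsilon> * ?P d) < 0"
        by (auto simp: mult_less_0_iff zero_less_mult_iff)
      then show ?thesis using torus[OF C, of "- d" d \<epsilon>] d by auto
    qed
    then show ?thesis using e1(1) e2(1) by (intro exI[of _ "min e1 e2"]) auto
  qed
  show ?thesis using part1 part2 by blast
qed

end
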